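(* Let $\dim_{\mathbb{C}}\mathrm{Socle}(\mathcal{A}_{[n]})$ denote the vector space dimension of the socle of $\mathcal{A}_{[n]}$. Then $$\lim_{n\to\infty}\frac{\dim_{\mathbb{C}}\mathrm{Socle}(\mathcal{A}_{[n]})}{n}=1-\frac12+\sum_{i=1}^{\infty}\frac{\frac1{p_i}-\frac1{p_{i+1}}}{\prod_{j=1}^{i}p_j}\approx 0.60771435951661818 .$$
   Context: $p_i$ denotes the $i$-th prime. For a positive integer $n$, $\mathcal{A}_{[n]}$ is the commutative $\mathbb{C}$-algebra with $\mathbb{C}$-basis $e_1,\dots,e_n$ and multiplication $e_a e_b=e_{ab}$ if $\gcd(a,b)=1$ and $ab\le n$, and $e_ae_b=0$ otherwise (the truncation to $[n]=\{1,\dots,n\}$ of the ring of arithmetical functions with unitary convolution; $e_k$ is the characteristic function of $\{k\}$). It is a local artinian ring with identity $e_1$ and maximal ideal spanned by $e_2,\dots,e_n$. Its socle is the annihilator of this maximal ideal. *)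

theory Defs
  imports
    Complex_Main
    "HOL-Library.Function_Algebras"
    "HOL-Library.Infinite_Set"
    "HOL-Computational_Algebra.Primes"
    "HOL-Algebra.Ideal"
begin

text \<open>
  Arithmetical functions are functions \<open>nat \<Rightarrow> complex\<close> with the pointwise vector space
  structure. Library notions of span and dimension over the complex numbers are obtained by
  interpreting \<^locale>\<open>vector_space\<close>.
\<close>

definition cscale :: "complex \<Rightarrow> (nat \<Rightarrow> complex) \<Rightarrow> nat \<Rightarrow> complex"
  where "cscale c f = (\<lambda>k. c * f k)"

interpretation cfun: vector_space cscale
  by unfold_locales (auto simp: cscale_def fun_eq_iff algebra_simps)

definition char_fun :: "nat \<Rightarrow> nat \<Rightarrow> complex"
  where "char_fun k = (\<lambda>m. if m = k then 1 else 0)"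

definition unitary_mult :: "nat \<Rightarrow> (nat \<Rightarrow> complex) \<Rightarrow> (nat \<Rightarrow> complex) \<Rightarrow> nat \<Rightarrow> complex"
  where "unitary_mult n f g =
    (\<lambda>k. if k \<in> {1..n} then \<Sum>(a, b)\<in>{(a, b). a * b = k \<and> coprime a b}. f a * g b else 0)"

text \<open>
  The truncated algebra: its elements are the functions vanishing outside \<open>{1..n}\<close>, so that
  index \<open>0\<close> (which is not a positive integer) plays no role. That the functions \<open>char_fun k\<close>
  form a basis with the expected multiplication table is proved below.
\<close>

definition unitary_alg :: "nat \<Rightarrow> (nat \<Rightarrow> complex) ring"
  where "unitary_alg n =
    \<lparr>carrier = {f. \<forall>k. k \<notin> {1..n} \<longrightarrow> f k = 0},
     mult = unitary_mult n, one = char_fun 1, zero = 0, add = (+)\<rparr>"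

definition max_ideal :: "nat \<Rightarrow> (nat \<Rightarrow> complex) set"
  where "max_ideal n = cfun.span (char_fun ` {2..n})"

definition socle :: "nat \<Rightarrow> (nat \<Rightarrow> complex) set"
  where "socle n =
    {f \<in> carrier (unitary_alg n).
       \<forall>g \<in> max_ideal n. f \<otimes>\<^bsub>unitary_alg n\<^esub> g = \<zero>\<^bsub>unitary_alg n\<^esub>}"

text \<open>The primes are numbered from \<open>1\<close>, whereas \<^const>\<open>enumerate\<close> counts from \<open>0\<close>;
  the value at \<open>0\<close> is never used.\<close>

definition nth_prime :: "nat \<Rightarrow> nat"
  where "nth_prime i = enumerate {p. prime p} (i - 1)"

definition series_term :: "nat \<Rightarrow> real"
  where "series_term i =
    (1 / real (nth_prime i) - 1 / real (nth_prime (i + 1))) / real (\<Prod>j = 1..i. nth_prime j)"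

lemma nth_prime_1: "nth_prime 1 = 2"
  unfolding nth_prime_def
  by (auto simp: enumerate_0 intro!: Least_equality dest: prime_ge_2_nat)

lemma finite_coprime_factorizations:
  assumes "k > 0"
  shows "finite {(a, b). a * b = k \<and> coprime a (b::nat)}"
proof (rule finite_subset)
  show "{(a, b). a * b = k \<and> coprime a b} \<subseteq> {..k} \<times> {..k}"
    using assms by (auto intro: dvd_imp_le)
qed auto

lemma char_fun_mult:
  assumes "a \<in> {1..n}" "b \<in> {1..n}"
  shows "char_fun a \<otimes>\<^bsub>unitary_alg n\<^esub> char_fun b =
    (if coprime a b \<and> a * b \<le> n then char_fun (a * b) else 0)"
proof
  fix k
  show "(char_fun a \<otimes>\<^bsub>unitary_alg n\<^esub> char_fun b) k =
    (if coprime a b \<and> a * b \<le> n then char_fun (a * b) else 0) k"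
  proof (cases "k \<in> {1..n}")
    case True
    have "(\<Sum>(x, y)\<in>{(x, y). x * y = k \<and> coprime x y}. char_fun a x * char_fun b y)
      = (\<Sum>p\<in>{(x, y). x * y = k \<and> coprime x y}. if p = (a, b) then 1 else 0)"
      by (intro sum.cong) (auto simp: char_fun_def split: if_splits)
    also have "\<dots> = (if a * b = k \<and> coprime a b then 1 else 0)"
      using True finite_coprime_factorizations[of k] by (subst sum.delta) auto
    finally show ?thesis
      using True by (auto simp: unitary_alg_def unitary_mult_def char_fun_def)
  next
    case False
    then show ?thesis
      using assms by (auto simp: unitary_alg_def unitary_mult_def char_fun_def)
  qed
qed

lemma inj_char_fun: "inj char_fun"
  by (auto simp: inj_def char_fun_def fun_eq_iff split: if_splits)

lemma sum_fun_apply: "(\<Sum>x\<in>A. (g x :: nat \<Rightarrow> complex)) k = (\<Sum>x\<in>A. g x k)"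
  by (induction A rule: infinite_finite_induct) auto

lemma fun_eq_sum_char_fun:
  assumes "finite A" "\<forall>k. k \<notin> A \<longrightarrow> f k = 0"
  shows "f = (\<Sum>k\<in>A. cscale (f k) (char_fun k))"
proof
  fix m
  have "(\<Sum>k\<in>A. cscale (f k) (char_fun k)) m = (\<Sum>k\<in>A. if k = m then f k else 0)"
    unfolding sum_fun_apply by (intro sum.cong) (auto simp: cscale_def char_fun_def)
  also have "\<dots> = f m"
    using assms by simp
  finally show "f m = (\<Sum>k\<in>A. cscale (f k) (char_fun k)) m" ..
qed

lemma span_char_fun:
  assumes "finite A"
  shows "cfun.span (char_fun ` A) = {f. \<forall>k. k \<notin> A \<longrightarrow> f k = 0}"
proof (intro equalityI subsetI)
  fix f assume "f \<in> cfun.span (char_fun ` A)"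
  then show "f \<in> {f. \<forall>k. k \<notin> A \<longrightarrow> f k = 0}"
    by (induction rule: cfun.span_induct_alt) (auto simp: cscale_def char_fun_def split: if_splits)
next
  fix f :: "nat \<Rightarrow> complex"
  assume "f \<in> {f. \<forall>k. k \<notin> A \<longrightarrow> f k = 0}"
  then have "f = (\<Sum>k\<in>A. cscale (f k) (char_fun k))"
    using fun_eq_sum_char_fun[OF assms] by blast
  also have "\<dots> \<in> cfun.span (char_fun ` A)"
    by (intro cfun.span_sum cfun.span_scale cfun.span_base) auto
  finally show "f \<in> cfun.span (char_fun ` A)" .
qed

lemma independent_char_fun: "cfun.independent (char_fun ` A)"
  unfolding cfun.dependent_explicit
proof (intro notI, elim exE conjE bexE)
  fix S u v assume S: "finite S" "S \<subseteq> char_fun ` A" "(\<Sum>v\<in>S. cscale (u v) v) = 0"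
    and v: "v \<in> S" "u v \<noteq> 0"
  from v S obtain a where a: "v = char_fun a" by blast
  have wv: "w a = (if w = v then 1 else 0)" if "w \<in> S" for w
  proof -
    from that S(2) obtain b where b: "w = char_fun b" by blast
    have "w = v \<longleftrightarrow> b = a" using inj_char_fun by (auto simp: a b inj_def)
    then show ?thesis by (auto simp: b char_fun_def)
  qed
  have eq: "(\<Sum>w\<in>S. cscale (u w) w a) = (\<Sum>w\<in>S. if w = v then u w else 0)"
    by (intro sum.cong refl) (simp add: cscale_def wv)
  have "0 = (\<Sum>v\<in>S. cscale (u v) v) a" using S by simp
  also have "\<dots> = (\<Sum>w\<in>S. if w = v then u w else 0)"
    unfolding sum_fun_apply by (rule eq)
  also have "\<dots> = u v" using S v by simp
  finally show False using v by simp
qed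

lemma carrier_unitary_alg: "carrier (unitary_alg n) = cfun.span (char_fun ` {1..n})"
  by (simp add: span_char_fun unitary_alg_def)

lemma max_ideal_eq: "max_ideal n = {f. \<forall>k. k \<notin> {2..n} \<longrightarrow> f k = 0}"
  by (simp add: span_char_fun max_ideal_def)

lemma unitary_mult_commute: "unitary_mult n f g = unitary_mult n g f"
proof -
  have "(\<Sum>(a, b)\<in>{(a, b). a * b = k \<and> coprime a b}. f a * g b) =
        (\<Sum>(a, b)\<in>{(a, b). a * b = k \<and> coprime a b}. g a * f b)" for k :: nat
    by (rule sum.reindex_bij_witness[of _ prod.swap prod.swap])
      (auto simp: mult.commute coprime_commute)
  then show ?thesis unfolding unitary_mult_def by auto
qed

lemma unitary_mult_assoc:
  "unitary_mult n (unitary_mult n f g) h = unitary_mult n f (unitary_mult n g h)"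
proof
  fix k
  show "unitary_mult n (unitary_mult n f g) h k = unitary_mult n f (unitary_mult n g h) k"
  proof (cases "k \<in> {1..n}")
    case True
    define F where "F = (\<lambda>k::nat. {(a, b). a * b = k \<and> coprime a b})"
    have fin: "finite (F m)" if "m > 0" for m
      using finite_coprime_factorizations[OF that] by (simp add: F_def)
    have um: "unitary_mult n u v m = (\<Sum>(a, b)\<in>F m. u a * v b)" if "m dvd k" for u v m
    proof -
      have "m \<in> {1..n}"
        using that True dvd_imp_le[of m k] by (cases "m = 0") auto
      then show ?thesis by (simp add: unitary_mult_def F_def)
    qed
    have pos: "a > 0" "b > 0" "a dvd k" "b dvd k" if "(a, b) \<in> F k" for a b
      using that True by (auto simp: F_def intro: Nat.gr0I)
    have "unitary_mult n (unitary_mult n f g) h k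
        = (\<Sum>p\<in>F k. \<Sum>q\<in>F (fst p). f (fst q) * g (snd q) * h (snd p))"
      unfolding um[OF dvd_refl]
      by (intro sum.cong refl) (auto simp: um pos sum_distrib_right case_prod_unfold)
    also have "\<dots> = (\<Sum>(p, q)\<in>Sigma (F k) (\<lambda>p. F (fst p)). f (fst q) * g (snd q) * h (snd p))"
      using fin pos True by (intro sum.Sigma) auto
    also have "\<dots> = (\<Sum>(p, q)\<in>Sigma (F k) (\<lambda>p. F (snd p)). f (fst p) * (g (fst q) * h (snd q)))"
      by (rule sum.reindex_bij_witness
          [of _ "\<lambda>((a, bc), (b, c)). ((a * b, c), (a, b))" "\<lambda>((ab, c), (a, b)). ((a, b * c), (b, c))"])
        (auto simp: F_def mult.assoc)
    also have "\<dots> = (\<Sum>p\<in>F k. \<Sum>q\<in>F (snd p). f (fst p) * (g (fst q) * h (snd q)))"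
      using fin pos True by (intro sum.Sigma[symmetric]) auto
    also have "\<dots> = unitary_mult n f (unitary_mult n g h) k"
      unfolding um[OF dvd_refl]
      by (intro sum.cong refl) (auto simp: um pos sum_distrib_left case_prod_unfold)
    finally show ?thesis .
  qed (auto simp: unitary_mult_def)
qed

lemma unitary_mult_one:
  assumes "f \<in> carrier (unitary_alg n)"
  shows "unitary_mult n (char_fun 1) f = f"
proof
  fix k
  show "unitary_mult n (char_fun 1) f k = f k"
  proof (cases "k \<in> {1..n}")
    case True
    have "(\<Sum>(a, b)\<in>{(a, b). a * b = k \<and> coprime a b}. char_fun 1 a * f b)
        = (\<Sum>p\<in>{(a, b). a * b = k \<and> coprime a b}. if p = (1, k) then f k else 0)"
      by (intro sum.cong) (auto simp: char_fun_def split: if_splits)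
    also have "\<dots> = f k"
      using True finite_coprime_factorizations[of k] by (subst sum.delta) auto
    finally show ?thesis using True by (simp add: unitary_mult_def)
  next
    case False
    then show ?thesis using assms by (auto simp: unitary_mult_def unitary_alg_def)
  qed
qed

lemma unitary_mult_add:
  "unitary_mult n (f + g) h = unitary_mult n f h + unitary_mult n g h"
  by (auto simp: unitary_mult_def fun_eq_iff case_prod_unfold algebra_simps sum.distrib)

lemma cring_unitary_alg:
  assumes "n \<ge> 1"
  shows "cring (unitary_alg n)"
proof (rule cringI)
  show "abelian_group (unitary_alg n)"
  proof (rule abelian_groupI)
    fix f assume "f \<in> carrier (unitary_alg n)"
    then show "\<exists>g\<in>carrier (unitary_alg n). g \<oplus>\<^bsub>unitary_alg n\<^esub> f = \<zero>\<^bsub>unitary_alg n\<^esub>"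
      by (intro bexI[of _ "- f"]) (auto simp: unitary_alg_def)
  qed (auto simp: unitary_alg_def add.assoc add.commute)
  show "comm_monoid (unitary_alg n)"
  proof (rule comm_monoidI)
    fix f assume "f \<in> carrier (unitary_alg n)"
    then show "\<one>\<^bsub>unitary_alg n\<^esub> \<otimes>\<^bsub>unitary_alg n\<^esub> f = f"
      using unitary_mult_one[of f n] by (simp add: unitary_alg_def)
  next
    show "\<one>\<^bsub>unitary_alg n\<^esub> \<in> carrier (unitary_alg n)"
      using assms by (auto simp: unitary_alg_def char_fun_def)
  next
    fix f g
    show "f \<otimes>\<^bsub>unitary_alg n\<^esub> g = g \<otimes>\<^bsub>unitary_alg n\<^esub> f"
      using unitary_mult_commute[of n f g] by (simp add: unitary_alg_def)
  next
    fix f g h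
    show "f \<otimes>\<^bsub>unitary_alg n\<^esub> g \<otimes>\<^bsub>unitary_alg n\<^esub> h =
      f \<otimes>\<^bsub>unitary_alg n\<^esub> (g \<otimes>\<^bsub>unitary_alg n\<^esub> h)"
      using unitary_mult_assoc[of n f g h] by (simp add: unitary_alg_def)
  next
    fix f g
    show "f \<otimes>\<^bsub>unitary_alg n\<^esub> g \<in> carrier (unitary_alg n)"
      by (auto simp: unitary_alg_def unitary_mult_def)
  qed
next
  fix f g h
  show "(f \<oplus>\<^bsub>unitary_alg n\<^esub> g) \<otimes>\<^bsub>unitary_alg n\<^esub> h =
    f \<otimes>\<^bsub>unitary_alg n\<^esub> h \<oplus>\<^bsub>unitary_alg n\<^esub> g \<otimes>\<^bsub>unitary_alg n\<^esub> h"
    using unitary_mult_add[of n f g h] by (simp add: unitary_alg_def)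
qed

lemma maximalideal_max_ideal:
  assumes "n \<ge> 1"
  shows "maximalideal (max_ideal n) (unitary_alg n)"
proof -
  interpret cring "unitary_alg n" by (rule cring_unitary_alg[OF assms])
  have M: "max_ideal n = {f \<in> carrier (unitary_alg n). f 1 = 0}"
  proof -
    have "k \<in> {2..n} \<longleftrightarrow> k \<in> {1..n} \<and> k \<noteq> 1" for k by auto
    then show ?thesis by (auto simp: max_ideal_eq unitary_alg_def)
  qed
  have mult_at_1: "(f \<otimes>\<^bsub>unitary_alg n\<^esub> g) 1 = f 1 * g 1" for f g
  proof -
    have "{(a, b). a * b = (1::nat) \<and> coprime a b} = {(1, 1)}" by auto
    then show ?thesis using assms by (simp add: unitary_alg_def unitary_mult_def)
  qed
  have neg: "\<ominus>\<^bsub>unitary_alg n\<^esub> f = - f" if "f \<in> carrier (unitary_alg n)" for f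
  proof (rule minus_equality)
    show "- f \<oplus>\<^bsub>unitary_alg n\<^esub> f = \<zero>\<^bsub>unitary_alg n\<^esub>" by (simp add: unitary_alg_def)
  qed (use that in \<open>auto simp: unitary_alg_def\<close>)
  show ?thesis
  proof (rule maximalidealI)
    show "ideal (max_ideal n) (unitary_alg n)"
    proof (rule idealI)
      show "subgroup (max_ideal n) (add_monoid (unitary_alg n))"
      proof (rule add.subgroupI)
        fix f assume "f \<in> max_ideal n"
        then have "\<ominus>\<^bsub>unitary_alg n\<^esub> f = - f" "- f \<in> max_ideal n"
          using neg by (auto simp: M) (auto simp: unitary_alg_def)
        then show "\<ominus>\<^bsub>unitary_alg n\<^esub> f \<in> max_ideal n" by simp
      next
        have "0 \<in> max_ideal n" by (simp add: max_ideal_eq)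
        then show "max_ideal n \<noteq> {}" by blast
      qed (auto simp: M unitary_alg_def)
    qed (auto simp: M mult_at_1[unfolded One_nat_def] ring_axioms)
    have "\<one>\<^bsub>unitary_alg n\<^esub> \<notin> max_ideal n"
      by (auto simp: M unitary_alg_def char_fun_def)
    then show "carrier (unitary_alg n) \<noteq> max_ideal n" by auto
  next
    fix J assume J: "ideal J (unitary_alg n)" "max_ideal n \<subseteq> J" "J \<subseteq> carrier (unitary_alg n)"
    then interpret J: ideal J "unitary_alg n" by simp
    show "J = max_ideal n \<or> J = carrier (unitary_alg n)"
    proof (rule disjCI)
      assume "J \<noteq> carrier (unitary_alg n)"
      show "J = max_ideal n"
      proof (rule ccontr)
        assume "J \<noteq> max_ideal n"
        then obtain f where f: "f \<in> J" "f 1 \<noteq> 0" using J by (auto simp: M)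
        define c where "c = cscale (1 / f 1) (char_fun 1)"
        have c: "c \<in> carrier (unitary_alg n)"
          using assms by (auto simp: c_def cscale_def char_fun_def unitary_alg_def)
        have cf: "c \<otimes>\<^bsub>unitary_alg n\<^esub> f \<in> J" using f c J.I_l_closed by blast
        have "\<one>\<^bsub>unitary_alg n\<^esub> \<ominus>\<^bsub>unitary_alg n\<^esub> (c \<otimes>\<^bsub>unitary_alg n\<^esub> f)
            = char_fun 1 - (c \<otimes>\<^bsub>unitary_alg n\<^esub> f)"
          using cf J(3) neg by (auto simp: a_minus_def) (simp add: unitary_alg_def)
        moreover have "(char_fun 1 - (c \<otimes>\<^bsub>unitary_alg n\<^esub> f)) 1 = 0"
          using f(2) mult_at_1[of c f] by (simp add: c_def cscale_def char_fun_def)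
        moreover have "\<one>\<^bsub>unitary_alg n\<^esub> \<ominus>\<^bsub>unitary_alg n\<^esub> (c \<otimes>\<^bsub>unitary_alg n\<^esub> f)
            \<in> carrier (unitary_alg n)"
          using cf J(3) by blast
        ultimately have "\<one>\<^bsub>unitary_alg n\<^esub> \<ominus>\<^bsub>unitary_alg n\<^esub> (c \<otimes>\<^bsub>unitary_alg n\<^esub> f) \<in> J"
          using J(2) by (auto simp: M)
        moreover have "\<one>\<^bsub>unitary_alg n\<^esub> = (\<one>\<^bsub>unitary_alg n\<^esub> \<ominus>\<^bsub>unitary_alg n\<^esub>
            (c \<otimes>\<^bsub>unitary_alg n\<^esub> f)) \<oplus>\<^bsub>unitary_alg n\<^esub> (c \<otimes>\<^bsub>unitary_alg n\<^esub> f)"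
          using cf J(3) by (auto simp: a_minus_def a_assoc l_neg)
        ultimately have "\<one>\<^bsub>unitary_alg n\<^esub> \<in> J" using cf J.a_closed by metis
        then show False using J.one_imp_carrier \<open>J \<noteq> carrier (unitary_alg n)\<close> by blast
      qed
    qed
  qed
qed

end

theory Submission
  imports Defs "HOL-Analysis.Uniform_Limit"
begin

text \<open>
  Multiplication by a basis vector \<open>e\<^sub>b\<close> sends distinct basis vectors to distinct basis vectors
  or to \<open>0\<close>, so the socle is spanned by those \<open>e\<^sub>k\<close> that every \<open>e\<^sub>b\<close> with \<open>b \<ge> 2\<close> annihilates:
  the \<open>k \<le> n\<close> with \<open>k b > n\<close> for all \<open>b \<ge> 2\<close> coprime to \<open>k\<close> (\<open>dim_socle\<close>). The smallest
  such \<open>b\<close> is the least prime that does not divide \<open>k\<close>.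

  The limit in the theorem is obtained by sorting these \<open>k\<close> by size rather than by that prime.
  Every \<open>k\<close> in \<open>(n/2, n]\<close> qualifies, which accounts for \<open>1 - 1/2\<close>. Every smaller \<open>k \<ge> 1\<close>
  lies in exactly one interval \<open>(n/p\<^sub>i\<^sub>+\<^sub>1, n/p\<^sub>i]\<close>, and there it qualifies if and only if its least
  non-dividing prime is at least \<open>p\<^sub>i\<^sub>+\<^sub>1\<close>, that is, if and only if \<open>p\<^sub>1 \<cdots> p\<^sub>i\<close> divides \<open>k\<close>
  (\<open>socle_indices_iff_layer\<close>). Counting multiples in an interval then gives the dimension
  exactly for every \<open>n\<close> (\<open>card_socle_indices\<close>, \<open>card_layer\<close>), and the \<open>i\<close>-th contribution divided by
  \<open>n\<close> tends to the \<open>i\<close>-th term of the series. Since that contribution is at most \<open>n / 2 ^ i\<close>,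
  uniformly in \<open>n\<close>, dominated convergence for series (Tannery's theorem) permits the
  interchange of limit and sum.

  For the numerical value, the tail of the series from index \<open>m\<close> on is bounded by a telescoping
  series with sum \<open>1 / (p\<^sub>m \<cdot> p\<^sub>1 \<cdots> p\<^sub>m)\<close> (\<open>series_tail_le\<close>); for \<open>m = 14\<close> this is below
  \<open>2 / 10 ^ 18\<close>, and the first \<open>13\<close> terms are summed exactly.
\<close>

section \<open>A monomial basis of the socle\<close>

definition socle_indices :: "nat \<Rightarrow> nat set"
  where "socle_indices n = {k \<in> {1..n}. \<forall>b\<ge>2. coprime k b \<longrightarrow> n < k * b}"

text \<open>
  The coefficient at \<open>k b\<close> isolates a single coefficient of \<open>f\<close> because \<open>k b\<close> and \<open>b\<close> determine
  \<open>k\<close>. This is what makes the annihilator of \<open>e\<^sub>b\<close> a monomial subspace.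
\<close>

lemma unitary_mult_char_fun:
  assumes "coprime k b" "k * b \<in> {1..n}"
  shows "unitary_mult n f (char_fun b) (k * b) = f k"
proof -
  have "k > 0" "b > 0" using assms by (auto intro: Nat.gr0I)
  have "(\<Sum>(x, y)\<in>{(x, y). x * y = k * b \<and> coprime x y}. f x * char_fun b y)
      = (\<Sum>p\<in>{(x, y). x * y = k * b \<and> coprime x y}. if p = (k, b) then f k else 0)"
    using \<open>b > 0\<close> by (intro sum.cong refl) (auto simp: char_fun_def split: if_splits)
  also have "\<dots> = f k"
    using assms finite_coprime_factorizations[of "k * b"] by (subst sum.delta) auto
  finally show ?thesis
    using assms(2) by (simp add: unitary_mult_def)
qed

text \<open>
  A product \<open>f e\<^sub>b = 0\<close> forces \<open>f k = 0\<close> whenever \<open>b\<close> is coprime to \<open>k\<close> and \<open>k b \<le> n\<close>. Conversely,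
  if \<open>f\<close> is supported on the socle indices, every product of coefficients of \<open>f\<close> and of an element
  of the maximal ideal that could contribute falls outside the truncation.
\<close>

lemma socle_eq: "socle n = {f. \<forall>k. k \<notin> socle_indices n \<longrightarrow> f k = 0}"
proof (intro equalityI subsetI CollectI allI impI)
  fix f k assume f: "f \<in> socle n" and k: "k \<notin> socle_indices n"
  show "f k = 0"
  proof (cases "k \<in> {1..n}")
    case True
    with k obtain b where b: "b \<ge> 2" "coprime k b" "k * b \<le> n"
      by (force simp: socle_indices_def)
    have "b \<le> n" using b(3) True by (metis atLeastAtMost_iff le_trans mult_le_mono1 nat_mult_1)
    then have "char_fun b \<in> max_ideal n"
      using b by (auto simp: max_ideal_eq char_fun_def)
    then have "unitary_mult n f (char_fun b) = 0"
      using f by (auto simp: socle_def unitary_alg_def)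
    then show ?thesis
      using unitary_mult_char_fun[of k b n f] b True by simp
  next
    case False
    then show ?thesis using f by (auto simp: socle_def unitary_alg_def)
  qed
next
  fix f :: "nat \<Rightarrow> complex"
  assume "f \<in> {f. \<forall>k. k \<notin> socle_indices n \<longrightarrow> f k = 0}"
  then have f: "f k = 0" if "k \<notin> socle_indices n" for k using that by blast
  have "unitary_mult n f g = 0" if g: "g \<in> max_ideal n" for g
  proof
    fix k
    have "f a * g b = 0" if "k \<in> {1..n}" "a * b = k" "coprime a b" for a b
    proof (cases "b \<ge> 2 \<and> a \<in> socle_indices n")
      case True
      then show ?thesis using that by (auto simp: socle_indices_def)
    next
      case False
      then show ?thesis using f[of a] g by (auto simp: max_ideal_eq)
    qed
    then show "unitary_mult n f g k = 0 k"
      by (auto simp: unitary_mult_def intro!: sum.neutral)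
  qed
  moreover have "f \<in> carrier (unitary_alg n)"
    using f by (force simp: unitary_alg_def socle_indices_def)
  ultimately show "f \<in> socle n" by (auto simp: socle_def unitary_alg_def)
qed

lemma dim_socle: "cfun.dim (socle n) = card (socle_indices n)"
proof -
  have "finite (socle_indices n)" by (simp add: socle_indices_def)
  then have "socle n = cfun.span (char_fun ` socle_indices n)"
    by (simp add: socle_eq span_char_fun)
  then have "cfun.dim (socle n) = card (char_fun ` socle_indices n)"
    by (simp add: cfun.dim_eq_card_independent independent_char_fun)
  also have "\<dots> = card (socle_indices n)"
    by (intro card_image inj_on_subset[OF inj_char_fun]) auto
  finally show ?thesis .
qed

section \<open>The sequence of primes and its partial products\<close>

definition primorial :: "nat \<Rightarrow> nat"
  where "primorial i = (\<Prod>j = 1..i. nth_prime j)"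

lemma prime_nth_prime: "prime (nth_prime i)"
  using enumerate_in_set[OF primes_infinite] by (simp add: nth_prime_def)

lemma nth_prime_ge_2: "nth_prime i \<ge> 2"
  by (intro prime_ge_2_nat prime_nth_prime)

lemma nth_prime_pos: "nth_prime i > 0"
  using nth_prime_ge_2[of i] by linarith

lemma nth_prime_less: "1 \<le> i \<Longrightarrow> i < j \<Longrightarrow> nth_prime i < nth_prime j"
  unfolding nth_prime_def by (intro enumerate_mono primes_infinite) auto

lemma nth_prime_mono: "1 \<le> i \<Longrightarrow> i \<le> j \<Longrightarrow> nth_prime i \<le> nth_prime j"
  using nth_prime_less[of i j] by (cases "i = j") auto

lemma nth_prime_gt: "i < nth_prime (Suc i)"
proof (induction i)
  case (Suc i)
  then show ?case using nth_prime_less[of "Suc i" "Suc (Suc i)"] by simp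
qed (rule nth_prime_pos)

lemma ex_nth_prime:
  assumes "prime q"
  obtains i where "1 \<le> i" "q = nth_prime i"
proof -
  obtain m where "enumerate {p. prime p} m = q"
    using enumerate_Ex[OF primes_infinite] assms by auto
  then show ?thesis using that[of "Suc m"] by (simp add: nth_prime_def)
qed

lemma primorial_Suc: "primorial (Suc i) = primorial i * nth_prime (Suc i)"
  by (simp add: primorial_def)

lemma primorial_ge: "2 ^ i \<le> primorial i"
proof (induction i)
  case (Suc i)
  then show ?case using mult_le_mono[OF Suc nth_prime_ge_2[of "Suc i"]]
    by (simp add: primorial_Suc mult.commute)
qed (simp add: primorial_def)

lemma primorial_pos: "primorial i > 0"
  using primorial_ge[of i] by (meson less_le_trans zero_less_numeral zero_less_power)

lemma primorial_mono: "i \<le> j \<Longrightarrow> primorial i \<le> primorial j"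
  unfolding primorial_def
  by (intro dvd_imp_le prod_dvd_prod_subset prod_pos) (auto simp: nth_prime_pos)

text \<open>
  The listed primes are distinct, so divisibility by their product is divisibility by each.
\<close>

lemma primorial_dvd_iff: "primorial i dvd k \<longleftrightarrow> (\<forall>j\<in>{1..i}. nth_prime j dvd k)"
proof (induction i)
  case (Suc i)
  have "coprime (primorial i) (nth_prime (Suc i))"
    unfolding primorial_def
  proof (rule prod_coprime_left)
    fix j assume "j \<in> {1..i}"
    then show "coprime (nth_prime j) (nth_prime (Suc i))"
      using nth_prime_less[of j "Suc i"] prime_nth_prime
      by (intro primes_coprime) auto
  qed
  then have "primorial (Suc i) dvd k \<longleftrightarrow> primorial i dvd k \<and> nth_prime (Suc i) dvd k"
    unfolding primorial_Suc by (metis divides_mult dvd_mult_left dvd_mult_right)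
  with Suc show ?case by (auto simp: atLeastAtMostSuc_conv)
qed (simp add: primorial_def)

section \<open>Counting the socle indices\<close>

text \<open>
  The \<open>i\<close>-th layer consists of the socle indices in \<open>(n/p\<^sub>i\<^sub>+\<^sub>1, n/p\<^sub>i]\<close>; the bounds are multiplied out
  to stay within the natural numbers.
\<close>

definition layer :: "nat \<Rightarrow> nat \<Rightarrow> nat set"
  where "layer n i = {k. k * nth_prime i \<le> n \<and> n < k * nth_prime (Suc i) \<and> primorial i dvd k}"

text \<open>
  If some \<open>p\<^sub>j\<close> with \<open>j \<le> i\<close> fails to divide \<open>k\<close>, it is a coprime factor that keeps \<open>k p\<^sub>j\<close>
  within \<open>n\<close>. If all of them divide \<open>k\<close>, then any \<open>b \<ge> 2\<close> coprime to \<open>k\<close> has a prime factor of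
  at least \<open>p\<^sub>i\<^sub>+\<^sub>1\<close>, which already pushes \<open>k b\<close> beyond \<open>n\<close>.
\<close>

lemma socle_indices_iff_layer:
  assumes "1 \<le> i" "k * nth_prime i \<le> n" "n < k * nth_prime (Suc i)"
  shows "k \<in> socle_indices n \<longleftrightarrow> primorial i dvd k"
proof
  assume k: "k \<in> socle_indices n"
  show "primorial i dvd k"
    unfolding primorial_dvd_iff
  proof (intro ballI, rule ccontr)
    fix j assume j: "j \<in> {1..i}" "\<not> nth_prime j dvd k"
    then have "coprime k (nth_prime j)"
      using prime_imp_coprime[OF prime_nth_prime] by (simp add: coprime_commute)
    then have "n < k * nth_prime j"
      using k nth_prime_ge_2 by (auto simp: socle_indices_def)
    also have "\<dots> \<le> k * nth_prime i"
      using j nth_prime_mono by simp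
    finally show False using assms by simp
  qed
next
  assume dvd: "primorial i dvd k"
  have "n < k * b" if b: "b \<ge> 2" "coprime k b" for b
  proof -
    obtain q where q: "prime q" "q dvd b"
      using b(1) prime_factor_nat[of b] by auto
    obtain j where j: "1 \<le> j" "q = nth_prime j"
      using ex_nth_prime[OF q(1)] by blast
    have "\<not> q dvd k"
      using q b by (meson coprime_common_divisor not_prime_unit)
    then have "Suc i \<le> j"
      using dvd j by (auto simp: primorial_dvd_iff not_less_eq_eq)
    then have "nth_prime (Suc i) \<le> q"
      using j nth_prime_mono by simp
    also have "q \<le> b" using q b by (intro dvd_imp_le) auto
    finally have "k * nth_prime (Suc i) \<le> k * b" by (intro mult_le_mono2)
    with assms(3) show ?thesis by (rule less_le_trans)
  qed
  moreover have "k \<ge> 1" using assms(3) by (cases k) auto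
  moreover have "k \<le> n"
    using assms(2) nth_prime_pos[of i] by (metis Suc_leI le_trans mult_le_mono2 nat_mult_1_right One_nat_def)
  ultimately show "k \<in> socle_indices n" by (simp add: socle_indices_def)
qed

lemma ex_prime_bracket:
  assumes "k \<ge> 1" "2 * k \<le> n"
  obtains i where "1 \<le> i" "k * nth_prime i \<le> n" "n < k * nth_prime (Suc i)"
proof -
  \<comment> \<open>The index is shifted by one, so that the least \<open>j\<close> is the number of the last prime
    not exceeding \<open>n / k\<close>; it is positive because \<open>2 k \<le> n\<close>.\<close>
  define j where "j = (LEAST j. n < k * nth_prime (Suc j))"
  have "Suc n \<le> 1 * nth_prime (Suc (Suc n))" using nth_prime_gt[of "Suc n"] by simp
  also have "\<dots> \<le> k * nth_prime (Suc (Suc n))" by (intro mult_le_mono assms) auto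
  finally have ex: "n < k * nth_prime (Suc (Suc n))" by simp
  have j: "n < k * nth_prime (Suc j)"
    unfolding j_def using ex by (rule LeastI)
  have "j \<noteq> 0"
    using j assms nth_prime_1 by (intro notI) (simp add: mult.commute)
  then have "\<not> n < k * nth_prime (Suc (j - 1))"
    unfolding j_def by (intro not_less_Least) simp
  then show ?thesis
    using j \<open>j \<noteq> 0\<close> by (intro that[of j]) auto
qed

text \<open>
  The union may stop at \<open>n\<close> because \<open>p\<^sub>i \<ge> i + 1\<close> leaves no room below \<open>n\<close> for later layers.
\<close>

lemma socle_indices_eq:
  "socle_indices n = {n div 2<..n} \<union> (\<Union>i<n. layer n (Suc i))"
proof (intro equalityI subsetI)
  fix k assume k: "k \<in> socle_indices n"
  show "k \<in> {n div 2<..n} \<union> (\<Union>i<n. layer n (Suc i))"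
  proof (cases "2 * k \<le> n")
    case True
    have "k \<ge> 1" using k by (simp add: socle_indices_def)
    with True obtain i where i: "1 \<le> i" "k * nth_prime i \<le> n" "n < k * nth_prime (Suc i)"
      using ex_prime_bracket by blast
    then have "k \<in> layer n i"
      using k socle_indices_iff_layer by (simp add: layer_def)
    moreover have "i - 1 < n"
    proof -
      have "i - 1 < nth_prime i" using nth_prime_gt[of "i - 1"] i by simp
      also have "\<dots> \<le> k * nth_prime i" using \<open>k \<ge> 1\<close> by simp
      finally show ?thesis using i by simp
    qed
    ultimately show ?thesis
      using i by (intro UnI2 UN_I[of "i - 1"]) auto
  next
    case False
    then show ?thesis using k by (auto simp: socle_indices_def)
  qed
next
  fix k assume "k \<in> {n div 2<..n} \<union> (\<Union>i<n. layer n (Suc i))"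
  then show "k \<in> socle_indices n"
  proof
    assume k: "k \<in> {n div 2<..n}"
    have "n < k * b" if "b \<ge> 2" for b
    proof -
      have "n < k * 2" using k by auto
      also have "\<dots> \<le> k * b" using that by simp
      finally show ?thesis .
    qed
    then show ?thesis using k by (auto simp: socle_indices_def)
  next
    assume "k \<in> (\<Union>i<n. layer n (Suc i))"
    then show ?thesis using socle_indices_iff_layer[of "Suc _" k n] by (auto simp: layer_def)
  qed
qed

lemma card_multiples:
  assumes "m > 0"
  shows "card {k. 0 < k \<and> k \<le> x \<and> m dvd k} = x div (m :: nat)"
proof -
  have "{k. 0 < k \<and> k \<le> x \<and> m dvd k} = (\<lambda>t. m * t) ` {1..x div m}"
    using assms by (auto simp: less_eq_div_iff_mult_less_eq mult.commute elim!: dvdE)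
  then show ?thesis
    using assms by (simp add: card_image inj_on_def)
qed

text \<open>
  A layer is the difference of two nested sets of multiples of the primorial, those up to
  \<open>n div p\<^sub>i\<close> and those up to \<open>n div p\<^sub>i\<^sub>+\<^sub>1\<close>.
\<close>

lemma card_layer:
  assumes "1 \<le> i"
  shows "card (layer n i) =
    n div (nth_prime i * primorial i) - n div (nth_prime (Suc i) * primorial i)"
proof -
  define M where "M = (\<lambda>x. {k. 0 < k \<and> k \<le> x \<and> primorial i dvd k})"
  have "layer n i = M (n div nth_prime i) - M (n div nth_prime (Suc i))"
    using nth_prime_pos[of i] nth_prime_pos[of "Suc i"]
    by (auto simp: layer_def M_def less_eq_div_iff_mult_less_eq not_le intro: Nat.gr0I)
  moreover have "M (n div nth_prime (Suc i)) \<subseteq> M (n div nth_prime i)"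
    using div_le_mono2[OF nth_prime_pos nth_prime_mono[of i "Suc i"], of n] assms
    by (auto simp: M_def)
  moreover have "finite (M x)" for x by (auto simp: M_def)
  ultimately have "card (layer n i) = card (M (n div nth_prime i)) - card (M (n div nth_prime (Suc i)))"
    by (simp add: card_Diff_subset)
  then show ?thesis
    by (simp add: M_def card_multiples primorial_pos div_mult2_eq)
qed

lemma layer_empty:
  assumes "n \<le> i"
  shows "layer n (Suc i) = {}"
proof -
  have "False" if "k \<in> layer n (Suc i)" for k
  proof -
    have "k > 0" using that by (auto simp: layer_def intro: Nat.gr0I)
    have "nth_prime (Suc i) \<le> k * nth_prime (Suc i)" using \<open>k > 0\<close> by simp
    also have "\<dots> \<le> n" using that by (simp add: layer_def)
    finally show False using nth_prime_gt[of i] assms by simp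
  qed
  then show ?thesis by blast
qed

lemma layer_disjoint:
  assumes "i < j" "1 \<le> i"
  shows "layer n i \<inter> layer n j = {}"
proof -
  have "k * nth_prime (Suc i) \<le> k * nth_prime j" for k
    using assms by (intro mult_le_mono nth_prime_mono) auto
  then have "\<not> (k * nth_prime j \<le> n \<and> n < k * nth_prime (Suc i))" for k
    by (meson leD le_trans)
  then show ?thesis unfolding layer_def by blast
qed

lemma card_socle_indices:
  "card (socle_indices n) = (n - n div 2) + (\<Sum>i<n. card (layer n (Suc i)))"
proof -
  have fin: "finite (layer n (Suc i))" for i
    using socle_indices_eq[of n] layer_empty[of n i]
    by (cases "i < n") (auto intro!: finite_subset[of "layer n (Suc i)" "socle_indices n"]
        simp: socle_indices_def)
  have "{n div 2<..n} \<inter> layer n (Suc i) = {}" for i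
  proof -
    have "k * 2 \<le> n" if "k * nth_prime (Suc i) \<le> n" for k
      using that mult_le_mono2[OF nth_prime_ge_2[of "Suc i"], of k] by linarith
    then show ?thesis by (force simp: layer_def)
  qed
  then have "card (socle_indices n) = card {n div 2<..n} + card (\<Union>i<n. layer n (Suc i))"
    unfolding socle_indices_eq using fin by (intro card_Un_disjoint) auto
  also have "card (\<Union>i<n. layer n (Suc i)) = (\<Sum>i<n. card (layer n (Suc i)))"
  proof (rule card_UN_disjoint)
    show "\<forall>i\<in>{..<n}. \<forall>j\<in>{..<n}. i \<noteq> j \<longrightarrow> layer n (Suc i) \<inter> layer n (Suc j) = {}"
      using layer_disjoint[of "Suc _" "Suc _" n] by (auto simp: nat_neq_iff)
  qed (use fin in auto)
  finally show ?thesis by simp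
qed

section \<open>Passage to the limit\<close>

lemma series_term_eq:
  "series_term i = 1 / real (nth_prime i * primorial i) - 1 / real (nth_prime (Suc i) * primorial i)"
  by (simp add: series_term_def primorial_def diff_divide_distrib)

lemma tendsto_div_over_self:
  assumes "m > (0 :: nat)"
  shows "(\<lambda>n. real (n div m) / real n) \<longlonglongrightarrow> 1 / real m"
proof (rule tendsto_sandwich)
  show "eventually (\<lambda>n. 1 / real m - 1 / real n \<le> real (n div m) / real n) sequentially"
    using eventually_gt_at_top[of 0]
  proof eventually_elim
    case (elim n)
    have "real n / real m - 1 \<le> real (n div m)"
      using floor_divide_of_nat_eq[of n m, where ?'a = real] by linarith
    then have "(real n / real m - 1) / real n \<le> real (n div m) / real n"
      by (intro divide_right_mono) auto
    then show ?case using elim by (simp add: diff_divide_distrib)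
  qed
  show "eventually (\<lambda>n. real (n div m) / real n \<le> 1 / real m) sequentially"
    using eventually_gt_at_top[of 0]
  proof eventually_elim
    case (elim n)
    have "real (n div m) / real n \<le> (real n / real m) / real n"
      by (intro divide_right_mono of_nat_div_le_of_nat) auto
    then show ?case using elim by simp
  qed
  show "(\<lambda>n. 1 / real m - 1 / real n) \<longlonglongrightarrow> 1 / real m"
    using tendsto_diff[OF tendsto_const[of "1 / real m"] lim_1_over_n] by simp
qed auto

lemma card_layer_real:
  assumes "1 \<le> i"
  shows "real (card (layer n i)) = real (n div (nth_prime i * primorial i))
    - real (n div (nth_prime (Suc i) * primorial i))"
proof -
  have "n div (nth_prime (Suc i) * primorial i) \<le> n div (nth_prime i * primorial i)"
    using assms nth_prime_pos primorial_pos
    by (intro div_le_mono2 mult_le_mono1 nth_prime_mono) auto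
  then show ?thesis using card_layer[OF assms] by simp
qed

lemma layer_density_tendsto:
  assumes "1 \<le> i"
  shows "(\<lambda>n. real (card (layer n i)) / real n) \<longlonglongrightarrow> series_term i"
  unfolding card_layer_real[OF assms] diff_divide_distrib series_term_eq
  by (intro tendsto_diff tendsto_div_over_self) (auto simp: nth_prime_pos primorial_pos)

text \<open>
  The bound does not depend on \<open>n\<close>; it is the summable majorant for dominated convergence. It
  follows from \<open>p\<^sub>1 \<cdots> p\<^sub>i \<ge> 2 ^ i\<close>.
\<close>

lemma layer_density_le:
  assumes "1 \<le> i"
  shows "real (card (layer n i)) / real n \<le> (1 / 2) ^ i"
proof -
  have "2 ^ i \<le> nth_prime i * primorial i"
    using mult_le_mono[OF _ primorial_ge, of 1 "nth_prime i" i] nth_prime_pos[of i] by simp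
  then have "n div (nth_prime i * primorial i) \<le> n div 2 ^ i"
    by (intro div_le_mono2) auto
  then have "card (layer n i) \<le> n div 2 ^ i"
    using card_layer[OF assms, of n] by linarith
  then have "real (card (layer n i)) \<le> real (n div 2 ^ i)" by simp
  also have "\<dots> \<le> real n / 2 ^ i"
    using of_nat_div_le_of_nat[of n "2 ^ i"] by simp
  finally have "real (card (layer n i)) / real n \<le> (real n / 2 ^ i) / real n"
    by (intro divide_right_mono) auto
  also have "\<dots> \<le> (1 / 2) ^ i" by (simp add: power_one_over)
  finally show ?thesis .
qed

text \<open>
  Only finitely many layers are nonempty for each \<open>n\<close>, so the exact count of the dimension is an
  infinite series whose terms converge one by one under a common summable bound.
\<close>

lemma socle_density:
  "summable (\<lambda>i. series_term (i + 1))"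
  "(\<lambda>n. real (cfun.dim (socle n)) / real n) \<longlonglongrightarrow> 1 - 1 / 2 + (\<Sum>i. series_term (i + 1))"
proof -
  define a where "a = (\<lambda>i n. real (card (layer n (Suc i))) / real n)"
  have "summable (\<lambda>i. (1 / 2 :: real) ^ Suc i)"
    unfolding summable_Suc_iff by (rule summable_geometric) simp
  moreover have "(\<lambda>n. a i n) \<longlonglongrightarrow> series_term (i + 1)" for i
    using layer_density_tendsto[of "Suc i"] by (simp add: a_def)
  moreover have "\<forall>\<^sub>F (i, n) in at_top \<times>\<^sub>F sequentially. norm (a i n) \<le> (1 / 2) ^ Suc i"
    using layer_density_le[of "Suc _"] by (intro always_eventually) (auto simp: a_def simp del: power_Suc)
  ultimately have T: "summable (\<lambda>i. norm (series_term (i + 1)))"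
    "(\<lambda>n. \<Sum>i. a i n) \<longlonglongrightarrow> (\<Sum>i. series_term (i + 1))"
    using tannerys_theorem[of a "\<lambda>i. series_term (i + 1)" sequentially "\<lambda>i. (1 / 2) ^ Suc i"]
    by auto
  from T(1) show "summable (\<lambda>i. series_term (i + 1))" by (rule summable_norm_cancel)
  have sum: "(\<Sum>i. a i n) = (\<Sum>i<n. a i n)" for n
    by (rule suminf_finite) (auto simp: a_def layer_empty)
  have "\<forall>\<^sub>F n in sequentially. 1 - real (n div 2) / real n + (\<Sum>i. a i n)
      = real (cfun.dim (socle n)) / real n"
    using eventually_gt_at_top[of 0]
  proof eventually_elim
    case (elim n)
    then have "1 - real (n div 2) / real n = real (n - n div 2) / real n"
      by (simp add: diff_divide_distrib of_nat_diff)
    then show ?case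
      unfolding dim_socle card_socle_indices sum
      by (simp only: a_def sum_divide_distrib add_divide_distrib of_nat_add of_nat_sum)
  qed
  moreover have "(\<lambda>n. 1 - real (n div 2) / real n + (\<Sum>i. a i n))
      \<longlonglongrightarrow> 1 - 1 / 2 + (\<Sum>i. series_term (i + 1))"
    using tendsto_div_over_self[of 2]
    by (intro tendsto_add tendsto_diff tendsto_const T(2)) auto
  ultimately show "(\<lambda>n. real (cfun.dim (socle n)) / real n)
      \<longlonglongrightarrow> 1 - 1 / 2 + (\<Sum>i. series_term (i + 1))"
    by (rule Lim_transform_eventually[rotated])
qed

section \<open>Numerical evaluation of the series\<close>

lemma series_term_nonneg:
  assumes "1 \<le> i"
  shows "0 \<le> series_term i"
proof -
  have "0 < real (nth_prime i)" "real (nth_prime i) \<le> real (nth_prime (i + 1))"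
    using nth_prime_mono[of i "i + 1"] nth_prime_pos[of i] assms by auto
  then show ?thesis
    unfolding series_term_def by (intro divide_nonneg_nonneg) (auto simp: divide_simps intro: prod_nonneg)
qed

text \<open>
  From index \<open>m\<close> on, replacing each denominator \<open>p\<^sub>1 \<cdots> p\<^sub>i\<close> by \<open>p\<^sub>1 \<cdots> p\<^sub>m\<close> only increases the
  terms and makes them telescope.
\<close>

lemma series_tail_le:
  assumes "1 \<le> m"
  shows "(\<Sum>i. series_term (i + m)) \<le> 1 / real (nth_prime m * primorial m)"
proof -
  define g where "g = (\<lambda>i. 1 / real (nth_prime (i + m)) / real (primorial m))"
  have "(\<lambda>i. 1 / real (nth_prime (i + m))) \<longlonglongrightarrow> 0"
  proof (rule tendsto_sandwich)
    show "\<forall>\<^sub>F i in sequentially. 1 / real (nth_prime (i + m)) \<le> 1 / real i"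
      using eventually_gt_at_top[of 0]
    proof eventually_elim
      case (elim i)
      have "i \<le> nth_prime (i + m)"
        using nth_prime_gt[of i] nth_prime_mono[of "Suc i" "i + m"] assms by simp
      then show ?case using elim by (intro divide_left_mono) (auto simp: nth_prime_pos)
    qed
    show "\<forall>\<^sub>F i in sequentially. 0 \<le> 1 / real (nth_prime (i + m))" by simp
  qed (use lim_1_over_n in auto)
  then have "g \<longlonglongrightarrow> 0"
    unfolding g_def by (rule tendsto_divide_zero)
  then have g: "(\<lambda>i. g i - g (Suc i)) sums (g 0 - 0)"
    by (rule telescope_sums')
  have le: "series_term (i + m) \<le> g i - g (Suc i)" for i
  proof -
    have "1 / real (nth_prime (i + m)) - 1 / real (nth_prime (i + m + 1)) \<ge> 0"
      using nth_prime_mono[of "i + m" "i + m + 1"] assms nth_prime_pos[of "i + m"]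
      by (simp add: frac_le)
    then have "series_term (i + m) \<le>
        (1 / real (nth_prime (i + m)) - 1 / real (nth_prime (i + m + 1))) / real (primorial m)"
      unfolding series_term_def primorial_def[symmetric]
      using primorial_mono[of m "i + m"] primorial_pos
      by (intro divide_left_mono) auto
    then show ?thesis by (simp add: g_def diff_divide_distrib)
  qed
  have "summable (\<lambda>i. series_term (i + m))"
    using le series_term_nonneg assms
    by (intro summable_comparison_test[OF _ sums_summable[OF g]]) auto
  then have "(\<Sum>i. series_term (i + m)) \<le> (\<Sum>i. g i - g (Suc i))"
    using le sums_summable[OF g] by (intro suminf_le)
  also have "\<dots> = 1 / real (nth_prime m * primorial m)"
    using sums_unique[OF g] by (simp add: g_def)
  finally show ?thesis .
qed

lemma nth_prime_SucI:
  assumes "1 \<le> i" "nth_prime i = p" "prime q" "p < q" "\<forall>m\<in>set [Suc p..<q]. \<not> prime m"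
  shows "nth_prime (Suc i) = q"
proof -
  have "nth_prime (Suc i) = (LEAST s. prime s \<and> p < s)"
    using assms(1,2) enumerate_Suc''[OF primes_infinite, of "i - 1"] by (simp add: nth_prime_def)
  also have "\<dots> = q"
    using assms(3-5) by (intro Least_equality) (auto simp: not_less Suc_le_eq)
  finally show ?thesis .
qed

lemma nth_prime_numerals:
  "nth_prime (Suc 0) = 2" "nth_prime 2 = 3" "nth_prime 3 = 5" "nth_prime 4 = 7" "nth_prime 5 = 11"
  "nth_prime 6 = 13" "nth_prime 7 = 17" "nth_prime 8 = 19" "nth_prime 9 = 23" "nth_prime 10 = 29"
  "nth_prime 11 = 31" "nth_prime 12 = 37" "nth_prime 13 = 41" "nth_prime 14 = 43"
proof -
  show 1: "nth_prime (Suc 0) = 2" using nth_prime_1 by simp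
  show 2: "nth_prime 2 = 3" using nth_prime_SucI[OF _ 1, of 3] by (simp add: numeral_2_eq_2[symmetric])
  show 3: "nth_prime 3 = 5" using nth_prime_SucI[OF _ 2, of 5] by simp
  show 4: "nth_prime 4 = 7" using nth_prime_SucI[OF _ 3, of 7] by simp
  show 5: "nth_prime 5 = 11" using nth_prime_SucI[OF _ 4, of 11] by simp
  show 6: "nth_prime 6 = 13" using nth_prime_SucI[OF _ 5, of 13] by simp
  show 7: "nth_prime 7 = 17" using nth_prime_SucI[OF _ 6, of 17] by simp
  show 8: "nth_prime 8 = 19" using nth_prime_SucI[OF _ 7, of 19] by simp
  show 9: "nth_prime 9 = 23" using nth_prime_SucI[OF _ 8, of 23] by simp
  show 10: "nth_prime 10 = 29" using nth_prime_SucI[OF _ 9, of 29] by simp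
  show 11: "nth_prime 11 = 31" using nth_prime_SucI[OF _ 10, of 31] by simp
  show 12: "nth_prime 12 = 37" using nth_prime_SucI[OF _ 11, of 37] by simp
  show 13: "nth_prime 13 = 41" using nth_prime_SucI[OF _ 12, of 41] by simp
  show 14: "nth_prime 14 = 43" using nth_prime_SucI[OF _ 13, of 43] by simp
qed

lemma primorial_1: "primorial (Suc 0) = 2"
  by (simp add: primorial_def nth_prime_numerals)

lemma primorial_numeral:
  "primorial (numeral k) = primorial (pred_numeral k) * nth_prime (numeral k)"
  by (simp add: numeral_eq_Suc primorial_Suc)

text \<open>
  With only the first \<open>13\<close> terms of the series, the expression exceeds the decimal by about
  \<open>0.98 / 10 ^ 18\<close>, and the tail adds less than \<open>1.8 / 10 ^ 18\<close>.
  Stopping one term earlier would not do: the tail bound would be about \<open>80 / 10 ^ 18\<close>.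
\<close>

lemma series_value:
  "\<bar>(1 - 1 / 2 + (\<Sum>i. series_term (i + 1))) - 0.60771435951661818\<bar> \<le> 5 / 10 ^ 18"
proof -
  define S where "S = (\<Sum>i<13. series_term (i + 1))"
  have split: "(\<Sum>i. series_term (i + 1)) = (\<Sum>i. series_term (i + 14)) + S"
    using suminf_split_initial_segment[OF socle_density(1), of 13]
    by (simp add: S_def add.assoc add.commute)
  have S: "S = 428749853972346411408403250417 / 3980433582824199458387646516300"
    by (simp add: S_def lessThan_nat_numeral series_term_eq primorial_numeral primorial_1
        nth_prime_numerals numeral_2_eq_2[symmetric] numeral_3_eq_3[symmetric])
  have "summable (\<lambda>i. series_term (i + 14))"
    using summable_ignore_initial_segment[OF socle_density(1), of 13]
    by (simp add: add.assoc add.commute del: summable_iff_shift)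
  then have "0 \<le> (\<Sum>i. series_term (i + 14))"
    by (intro suminf_nonneg series_term_nonneg) auto
  moreover have "(\<Sum>i. series_term (i + 14)) \<le> 1 / real (nth_prime 14 * primorial 14)"
    by (rule series_tail_le) simp
  moreover have "primorial 14 = 13082761331670030"
    by (simp add: primorial_numeral primorial_1 nth_prime_numerals)
  ultimately show ?thesis
    unfolding split S by (simp add: nth_prime_numerals abs_le_iff)
qed

theorem theorem7p2:
  shows "summable (\<lambda>i. series_term (i + 1)) \<and>
    ((\<lambda>n. real (cfun.dim (socle n)) / real n)
       \<longlonglongrightarrow> 1 - 1 / 2 + (\<Sum>i. series_term (i + 1))) \<and>
    \<bar>(1 - 1 / 2 + (\<Sum>i. series_term (i + 1))) - 0.60771435951661818\<bar> \<le> 5 / 10 ^ 18"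
  using socle_density series_value by blast

end
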